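(* A regular Hausdorff space $X$ is an $\alpha$-space if and only if $\mathcal{K}(X)$ is an $\alpha$-space.
   Context: $\mathcal{K}(X)$ is the set of nonempty compact subsets of $X$ with the Vietoris topology (base: $\langle U_1,\dots,U_k\rangle=\{K: K\subset\bigcup_i U_i,\ K\cap U_j\neq\emptyset\ \forall j\}$, $U_i$ open in $X$). A space $Y$ with topology $\tau_Y$ is an $\alpha$-space if there is a function $g:\mathbb{N}\times Y\to\tau_Y$ such that (i) $\bigcap_{m\in\mathbb{N}}g(m,x)=\{x\}$ for each $x\in Y$, and (ii) if $y\in g(m,x)$ then $g(m,y)\subset g(m,x)$. *)

theory Defs
  imports "HOL-Analysis.Analysis"
begin

definition vietoris_basic :: "'a topology \<Rightarrow> 'a set list \<Rightarrow> 'a set set" where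
  "vietoris_basic X Us =
     {K. K \<noteq> {} \<and> compactin X K \<and> K \<subseteq> \<Union>(set Us) \<and> (\<forall>U\<in>set Us. K \<inter> U \<noteq> {})}"

definition vietoris :: "'a topology \<Rightarrow> 'a set topology" where
  "vietoris X = topology_generated_by
     {vietoris_basic X Us | Us. Us \<noteq> [] \<and> (\<forall>U\<in>set Us. openin X U)}"

definition alpha_space :: "'a topology \<Rightarrow> bool" where
  "alpha_space Y \<longleftrightarrow> (\<exists>g :: nat \<Rightarrow> 'a \<Rightarrow> 'a set.
      (\<forall>m. \<forall>x\<in>topspace Y. openin Y (g m x)) \<and>
      (\<forall>x\<in>topspace Y. (\<Inter>m. g m x) = {x}) \<and>
      (\<forall>m. \<forall>x\<in>topspace Y. \<forall>y\<in>topspace Y. y \<in> g m x \<longrightarrow> g m y \<subseteq> g m x))"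

end

theory Submission
  imports Defs
begin

text \<open>
  If \<open>g\<close> witnesses that \<open>X\<close> is an \<open>\<alpha>\<close>-space, then each \<open>g i\<close> induces the preorder
  \<open>b \<le> a \<longleftrightarrow> b \<in> g i a\<close>. Breaking ties inside its equivalence classes by a well-order of \<open>X\<close>
  refines it to a preorder, with open principal ideals \<open>T i a\<close>, each of whose classes lies in the
  interior of one closed set \<open>D i a \<subseteq> g i a\<close>; regularity supplies the closed sets.

  A compact \<open>K\<close> is covered by finitely many \<open>P n a = (\<Inter>i\<le>n. T i a)\<close> with \<open>a \<in> K\<close>. Call \<open>t\<close>
  maximal for \<open>K\<close> if every \<open>x \<in> K\<close> with \<open>t \<in> P n x\<close> is in the \<open>T i\<close>-class of \<open>t\<close>. Only finitely
  many classes contain such a \<open>t\<close>, so only finitely many closed sets are relevant to \<open>K\<close>, and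
  \<open>M\<close> belongs to the neighbourhood \<open>V n K\<close> if \<open>M\<close> lies in the ideal generated by \<open>K\<close> and no
  union of closed sets, coming from elements of \<open>M\<close> that are maximal for \<open>K\<close>, contains \<open>M\<close>
  without containing \<open>K\<close>.
\<close>

section \<open>The Vietoris topology and the passage from the hyperspace to X\<close>

lemma topspace_vietoris: "topspace (vietoris X) = {K. K \<noteq> {} \<and> compactin X K}"
  unfolding vietoris_def topology_generated_by_topspace
proof (intro equalityI subsetI)
  fix K assume "K \<in> {K. K \<noteq> {} \<and> compactin X K}"
  then have "K \<in> vietoris_basic X [topspace X]"
    using compactin_subset_topspace[of X K] by (auto simp: vietoris_basic_def)
  moreover have "vietoris_basic X [topspace X] \<in>
      {vietoris_basic X Us | Us. Us \<noteq> [] \<and> (\<forall>U\<in>set Us. openin X U)}"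
    by (intro CollectI exI[of _ "[topspace X]"]) simp
  ultimately show "K \<in> \<Union>{vietoris_basic X Us | Us. Us \<noteq> [] \<and> (\<forall>U\<in>set Us. openin X U)}"
    by blast
qed (auto simp: vietoris_basic_def)

lemma openin_vietoris_basic:
  assumes "Us \<noteq> []" "\<And>U. U \<in> set Us \<Longrightarrow> openin X U"
  shows "openin (vietoris X) (vietoris_basic X Us)"
  unfolding vietoris_def using assms by (intro topology_generated_by_Basis) blast

text \<open>Continuity of \<open>x \<mapsto> {x}\<close>: a basic set contains \<open>{x}\<close>
  exactly when \<open>x\<close> lies in every member of \<open>Us\<close>.\<close>

lemma openin_vietoris_singletons:
  assumes "openin (vietoris X) W"
  shows "openin X {x \<in> topspace X. {x} \<in> W}"
proof -
  have "generate_topology_on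
      {vietoris_basic X Us | Us. Us \<noteq> [] \<and> (\<forall>U\<in>set Us. openin X U)} W"
    using assms unfolding vietoris_def openin_topology_generated_by_iff .
  then show ?thesis
  proof induction
    case Empty
    then show ?case by simp
  next
    case (Int a b)
    have "{x \<in> topspace X. {x} \<in> a \<inter> b} = {x \<in> topspace X. {x} \<in> a} \<inter> {x \<in> topspace X. {x} \<in> b}"
      by auto
    then show ?case using Int.IH by (simp only: openin_Int)
  next
    case (UN \<K>)
    have "{x \<in> topspace X. {x} \<in> \<Union>\<K>} = (\<Union>k\<in>\<K>. {x \<in> topspace X. {x} \<in> k})"
      by auto
    then show ?case using UN by auto
  next
    case (Basis s)
    then obtain Us where Us: "s = vietoris_basic X Us" "Us \<noteq> []" "\<forall>U\<in>set Us. openin X U"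
      by blast
    have "{x \<in> topspace X. {x} \<in> s} = \<Inter>(set Us)"
      using Us openin_subset by (fastforce simp: vietoris_basic_def neq_Nil_conv)
    then show ?case using Us by (auto intro: openin_Inter)
  qed
qed

text \<open>A witness pulls back along the continuous injection
  \<open>x \<mapsto> {x}\<close>.\<close>

lemma alpha_space_if_vietoris:
  assumes "alpha_space (vietoris X)"
  shows "alpha_space X"
proof -
  obtain g :: "nat \<Rightarrow> 'a set \<Rightarrow> 'a set set"
    where op: "\<And>m K. K \<in> topspace (vietoris X) \<Longrightarrow> openin (vietoris X) (g m K)"
      and sep: "\<And>K. K \<in> topspace (vietoris X) \<Longrightarrow> (\<Inter>m. g m K) = {K}"
      and tr: "\<And>m K L. K \<in> topspace (vietoris X) \<Longrightarrow> L \<in> topspace (vietoris X) \<Longrightarrow> L \<in> g m K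
        \<Longrightarrow> g m L \<subseteq> g m K"
    using assms unfolding alpha_space_def by metis
  have sing: "{x} \<in> topspace (vietoris X)" if "x \<in> topspace X" for x
    using that by (simp add: topspace_vietoris)
  define h where "h m x = {y \<in> topspace X. {y} \<in> g m {x}}" for m x
  have "openin X (h m x)" if "x \<in> topspace X" for m x
    unfolding h_def by (intro openin_vietoris_singletons op sing that)
  moreover have "(\<Inter>m. h m x) = {x}" if x: "x \<in> topspace X" for x
    using sep[OF sing[OF x]] x by (auto simp: h_def set_eq_iff)
  moreover have "h m y \<subseteq> h m x" if "x \<in> topspace X" "y \<in> topspace X" "y \<in> h m x" for m x y
    using tr[OF sing sing] that by (auto simp: h_def)
  ultimately show ?thesis
    unfolding alpha_space_def by (intro exI[of _ h]) blast
qed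

section \<open>Neighbourhoods of compact sets built from closed cells\<close>

lemma compactin_neighbourhood_cover:
  assumes C: "compactin X C" and W: "\<And>x. x \<in> C \<Longrightarrow> openin X (W x)" "\<And>x. x \<in> C \<Longrightarrow> x \<in> W x"
  obtains F where "finite F" "F \<subseteq> C" "C \<subseteq> (\<Union>x\<in>F. W x)"
proof -
  obtain \<F> where "finite \<F>" "\<F> \<subseteq> W ` C" "C \<subseteq> \<Union>\<F>"
    using compactinD[OF C, of "W ` C"] W by blast
  then show thesis using that finite_subset_image by metis
qed

text \<open>What the hyperspace construction uses: open ideals \<open>T i a\<close> of preorders,
  and closed neighbourhoods \<open>D i a\<close> that are constant on the classes of
  \<open>T i\<close>, so that finitely many classes yield finitely many closed sets.\<close>

locale closed_cells =
  fixes X :: "'a topology" and T D :: "nat \<Rightarrow> 'a \<Rightarrow> 'a set"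
  assumes T_open: "a \<in> topspace X \<Longrightarrow> openin X (T i a)"
    and T_refl: "a \<in> topspace X \<Longrightarrow> a \<in> T i a"
    and T_trans: "a \<in> topspace X \<Longrightarrow> b \<in> T i a \<Longrightarrow> T i b \<subseteq> T i a"
    and T_sep: "a \<in> topspace X \<Longrightarrow> b \<in> topspace X \<Longrightarrow> a \<noteq> b \<Longrightarrow> \<exists>i. b \<notin> T i a"
    and D_closed: "a \<in> topspace X \<Longrightarrow> closedin X (D i a)"
    and D_nhd: "a \<in> topspace X \<Longrightarrow> \<exists>U. openin X U \<and> a \<in> U \<and> U \<subseteq> D i a"
    and D_cong: "a \<in> topspace X \<Longrightarrow> b \<in> topspace X \<Longrightarrow> T i a = T i b \<Longrightarrow> D i a = D i b"
    and D_sep: "a \<in> topspace X \<Longrightarrow> b \<in> topspace X \<Longrightarrow> a \<noteq> b \<Longrightarrow> \<exists>i. b \<notin> D i a"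
begin

definition P :: "nat \<Rightarrow> 'a \<Rightarrow> 'a set" where
  "P n a = (\<Inter>i\<in>{..n}. T i a)"

definition U :: "nat \<Rightarrow> 'a set \<Rightarrow> 'a set" where
  "U n K = (\<Union>x\<in>K. P n x)"

text \<open>For \<open>i \<le> n\<close>, \<open>t \<in> P n x\<close> already gives
  \<open>T i t \<subseteq> T i x\<close>; equality forbids strict growth. The point \<open>t\<close>
  may lie outside \<open>K\<close>, since points of nearby compact sets are tested.\<close>

definition maximal_for :: "nat \<Rightarrow> nat \<Rightarrow> 'a set \<Rightarrow> 'a \<Rightarrow> bool" where
  "maximal_for n i K t \<longleftrightarrow> (\<forall>x\<in>K. t \<in> P n x \<longrightarrow> T i x = T i t)"

definition cells :: "nat \<Rightarrow> 'a set \<Rightarrow> 'a set \<Rightarrow> 'a set set" where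
  "cells n K M = {D i t | i t. i \<le> n \<and> t \<in> M \<and> maximal_for n i K t}"

text \<open>Read contrapositively, \<open>M\<close> must leave every union of cells that
  \<open>K\<close> leaves; this stands in for the Vietoris conditions of meeting open sets.\<close>

definition V :: "nat \<Rightarrow> 'a set \<Rightarrow> 'a set set" where
  "V n K = {M. M \<noteq> {} \<and> compactin X M \<and> M \<subseteq> U n K \<and>
     (\<forall>S\<subseteq>cells n K M. M \<subseteq> \<Union>S \<longrightarrow> K \<subseteq> \<Union>S)}"

lemma P_open: "a \<in> topspace X \<Longrightarrow> openin X (P n a)"
  unfolding P_def by (intro openin_INT2) (auto intro: T_open)

lemma P_refl: "a \<in> topspace X \<Longrightarrow> a \<in> P n a"
  by (simp add: P_def T_refl)

lemma P_trans: "a \<in> topspace X \<Longrightarrow> b \<in> P n a \<Longrightarrow> P n b \<subseteq> P n a"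
  using T_trans[of a b] unfolding P_def by blast

lemma P_subset_T: "i \<le> n \<Longrightarrow> P n a \<subseteq> T i a"
  by (auto simp: P_def)

lemma U_open: "K \<subseteq> topspace X \<Longrightarrow> openin X (U n K)"
  unfolding U_def by (auto intro: P_open)

lemma subset_U: "K \<subseteq> topspace X \<Longrightarrow> K \<subseteq> U n K"
  unfolding U_def using P_refl by blast

lemma U_trans: "K \<subseteq> topspace X \<Longrightarrow> N \<subseteq> U n K \<Longrightarrow> U n N \<subseteq> U n K"
  unfolding U_def using P_trans by (simp add: subset_iff) blast

text \<open>Finitely many sets \<open>T (i x) x\<close> missing \<open>y\<close> cover
  \<open>C\<close>. Once \<open>n\<close> exceeds their indices, \<open>y \<in> P n x\<close> would
  by transitivity put \<open>y\<close> into one of them.\<close>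

lemma U_escape:
  assumes C: "compactin X C" and y: "y \<in> topspace X" "y \<notin> C"
  shows "\<exists>m. \<forall>n\<ge>m. y \<notin> U n C"
proof -
  have CX: "C \<subseteq> topspace X" using C by (rule compactin_subset_topspace)
  then have "\<forall>x\<in>C. \<exists>i. y \<notin> T i x" using T_sep y by blast
  then obtain i where i: "\<And>x. x \<in> C \<Longrightarrow> y \<notin> T (i x) x" by metis
  obtain F where F: "finite F" "F \<subseteq> C" "C \<subseteq> (\<Union>x\<in>F. T (i x) x)"
    by (rule compactin_neighbourhood_cover[OF C, of "\<lambda>x. T (i x) x"]) (use CX T_open T_refl in auto)
  have "y \<notin> U n C" if n: "n \<ge> Max (insert 0 (i ` F))" for n
  proof
    assume "y \<in> U n C"
    then obtain x where x: "x \<in> C" "y \<in> P n x" by (auto simp: U_def)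
    then obtain z where z: "z \<in> F" "x \<in> T (i z) z" using F by blast
    have "i z \<le> n" using n F z by simp
    then have "y \<in> T (i z) x" using x P_subset_T by blast
    then have "y \<in> T (i z) z" using T_trans z F CX by blast
    then show False using i z F by blast
  qed
  then show ?thesis by blast
qed

text \<open>The points of \<open>K\<close> outside \<open>T i y\<close> form a compact set missing
  \<open>y\<close>, so \<open>U_escape\<close> excludes them for large \<open>n\<close>. Any other
  \<open>x\<close> with \<open>y \<in> P n x\<close> is equivalent to \<open>y\<close>.\<close>

lemma maximal_for_eventually:
  assumes K: "compactin X K" and y: "y \<in> topspace X"
  shows "\<exists>m. \<forall>n\<ge>m. maximal_for n i K y"
proof -
  have KX: "K \<subseteq> topspace X" using K by (rule compactin_subset_topspace)
  have "compactin X (K - T i y)"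
  proof -
    have "K - T i y = (topspace X - T i y) \<inter> K" using KX by auto
    moreover have "closedin X (topspace X - T i y)" using y by (intro closedin_diff T_open) auto
    ultimately show ?thesis using K by (simp only: closed_Int_compactin)
  qed
  then obtain m where m: "\<And>n. n \<ge> m \<Longrightarrow> y \<notin> U n (K - T i y)"
    using U_escape[OF _ y] T_refl[OF y] by blast
  have "maximal_for n i K y" if n: "n \<ge> max m i" for n
    unfolding maximal_for_def
  proof (intro ballI impI)
    fix x assume x: "x \<in> K" "y \<in> P n x"
    then have "x \<in> T i y" using m[of n] n by (auto simp: U_def)
    moreover have "y \<in> T i x" using x n P_subset_T by fastforce
    ultimately show "T i x = T i y" using T_trans x y KX by blast
  qed
  then show ?thesis by blast
qed

text \<open>If \<open>t \<in> M\<close> is maximal for \<open>K\<close>, any point of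
  \<open>N\<close> above \<open>t\<close> is squeezed between \<open>t\<close> and a point of
  \<open>K\<close> in the same class. Hence it shares the class and the cell of
  \<open>t\<close>.\<close>

lemma cells_trans:
  assumes KX: "K \<subseteq> topspace X" and N: "N \<subseteq> U n K" and M: "M \<subseteq> U n N"
  shows "cells n K M \<subseteq> cells n N M" and "cells n K M \<subseteq> cells n K N"
proof -
  have NX: "N \<subseteq> topspace X" using N U_open[OF KX] openin_subset by blast
  have MX: "M \<subseteq> topspace X" using M U_open[OF NX] openin_subset by blast
  {
    fix i t assume i: "i \<le> n" and t: "t \<in> M" "maximal_for n i K t"
    have eq: "T i n' = T i t \<and> maximal_for n i K n'" if n': "n' \<in> N" "t \<in> P n n'" for n'
    proof -
      obtain x where x: "x \<in> K" "n' \<in> P n x" using N n' by (auto simp: U_def)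
      have Tx: "T i x' = T i t" if "x' \<in> K" "n' \<in> P n x'" for x'
        using that n' t P_trans KX unfolding maximal_for_def by blast
      have "T i n' \<subseteq> T i x" using x KX P_subset_T[OF i] T_trans by blast
      moreover have "T i t \<subseteq> T i n'" using n' NX P_subset_T[OF i] T_trans by blast
      ultimately have "T i n' = T i t" using Tx x by blast
      then show ?thesis using Tx by (auto simp: maximal_for_def)
    qed
    have "maximal_for n i N t" using eq by (auto simp: maximal_for_def)
    then have "D i t \<in> cells n N M" using i t by (auto simp: cells_def)
    moreover obtain n' where n': "n' \<in> N" "t \<in> P n n'" using M t by (auto simp: U_def)
    then have "D i n' = D i t" using eq D_cong NX MX t by blast
    then have "D i t \<in> cells n K N" using eq[OF n'] n' i unfolding cells_def by blast
    ultimately have "D i t \<in> cells n N M \<and> D i t \<in> cells n K N" by blast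
  }
  then show "cells n K M \<subseteq> cells n N M" and "cells n K M \<subseteq> cells n K N"
    by (auto simp: cells_def[of n K M])
qed

text \<open>The two inclusions of \<open>cells_trans\<close> keep \<open>S\<close> admissible while
  covering passes from \<open>M\<close> to \<open>N\<close> and then from \<open>N\<close> to
  \<open>K\<close>.\<close>

lemma V_trans:
  assumes KX: "K \<subseteq> topspace X" and N: "N \<in> V n K"
  shows "V n N \<subseteq> V n K"
proof
  fix M assume M: "M \<in> V n N"
  have NU: "N \<subseteq> U n K" and MU: "M \<subseteq> U n N" using N M by (auto simp: V_def)
  have "M \<subseteq> U n K" using MU U_trans[OF KX NU] by blast
  moreover have "K \<subseteq> \<Union>S" if S: "S \<subseteq> cells n K M" "M \<subseteq> \<Union>S" for S
  proof -
    have "S \<subseteq> cells n N M" "S \<subseteq> cells n K N"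
      using S(1) cells_trans[OF KX NU MU] by blast+
    moreover from this have "N \<subseteq> \<Union>S" using S(2) M by (simp add: V_def)
    ultimately show ?thesis using N by (simp add: V_def)
  qed
  ultimately show "M \<in> V n K" using M by (auto simp: V_def)
qed

text \<open>Each maximal \<open>t \<in> K\<close> lies in one of finitely many \<open>P n x\<close>
  covering \<open>K\<close>; maximality puts \<open>t\<close> in the class of the centre
  \<open>x\<close>.\<close>

lemma finite_cells:
  assumes K: "compactin X K"
  shows "finite (cells n K K)"
proof -
  have KX: "K \<subseteq> topspace X" using K by (rule compactin_subset_topspace)
  obtain F where F: "finite F" "F \<subseteq> K" "K \<subseteq> (\<Union>x\<in>F. P n x)"
    by (rule compactin_neighbourhood_cover[OF K, of "P n"]) (use KX P_open P_refl in auto)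
  have "D i t \<in> (\<lambda>(i, x). D i x) ` ({..n} \<times> F)"
    if t: "i \<le> n" "t \<in> K" "maximal_for n i K t" for i t
  proof -
    obtain x where x: "x \<in> F" "t \<in> P n x" using F t by blast
    then have "T i x = T i t" using t F by (auto simp: maximal_for_def)
    then have "D i t = D i x" using D_cong t x F KX by blast
    then show ?thesis using x t by force
  qed
  then have "cells n K K \<subseteq> (\<lambda>(i, x). D i x) ` ({..n} \<times> F)"
    by (auto simp: cells_def)
  then show ?thesis by (rule finite_subset) (simp add: F(1))
qed

lemma V_refl:
  assumes "K \<noteq> {}" "compactin X K"
  shows "K \<in> V n K"
  using assms subset_U[OF compactin_subset_topspace] by (auto simp: V_def)

lemma V_nhd:
  assumes K: "K \<noteq> {}" "compactin X K"
  shows "\<exists>W. openin (vietoris X) W \<and> K \<in> W \<and> W \<subseteq> V n K"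
proof -
  have KX: "K \<subseteq> topspace X" using K(2) by (rule compactin_subset_topspace)
  define \<S> where "\<S> = {S \<in> Pow (cells n K K). \<not> K \<subseteq> \<Union>S}"
  have fin: "finite \<S>" using finite_cells[OF K(2)] by (simp add: \<S>_def)
  have cl: "closedin X (\<Union>S)" if "S \<in> \<S>" for S
  proof (rule closedin_Union)
    show "finite S" using that finite_cells[OF K(2)] finite_subset by (auto simp: \<S>_def)
    fix C assume "C \<in> S"
    then have "C \<in> cells n K K" using that by (auto simp: \<S>_def)
    then show "closedin X C" using KX by (auto simp: cells_def intro: D_closed)
  qed
  obtain Ss where Ss: "set Ss = \<S>" using fin finite_list by blast
  \<comment> \<open>Each complement meets \<open>K\<close> by the choice of \<open>\<S>\<close>; the
    entry \<open>U n K\<close> makes the union of the list equal to \<open>U n K\<close>.\<close>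
  define Us where "Us = U n K # map (\<lambda>S. U n K - \<Union>S) Ss"
  have set_Us: "set Us = insert (U n K) ((\<lambda>S. U n K - \<Union>S) ` \<S>)"
    by (simp add: Us_def Ss)
  have "openin (vietoris X) (vietoris_basic X Us)"
    by (rule openin_vietoris_basic)
      (auto simp: Us_def Ss intro!: openin_diff cl U_open KX)
  moreover have "K \<in> vietoris_basic X Us"
    using K subset_U[OF KX, of n] by (auto simp: vietoris_basic_def set_Us \<S>_def)
  moreover have "vietoris_basic X Us \<subseteq> V n K"
  proof
    fix M assume M: "M \<in> vietoris_basic X Us"
    then have MU: "M \<subseteq> U n K" by (auto simp: vietoris_basic_def set_Us)
    have "K \<subseteq> \<Union>S" if S: "S \<subseteq> cells n K M" "M \<subseteq> \<Union>S" for S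
    proof (rule ccontr)
      assume "\<not> K \<subseteq> \<Union>S"
      \<comment> \<open>Taking \<open>N = K\<close> in \<open>cells_trans\<close> shows that
        \<open>M\<close> contributes no cells beyond the finitely many of \<open>K\<close>.\<close>
      moreover have "S \<subseteq> cells n K K"
        using S cells_trans(2)[OF KX subset_U[OF KX] MU] by blast
      ultimately have "S \<in> \<S>" by (simp add: \<S>_def)
      then have "M \<inter> (U n K - \<Union>S) \<noteq> {}" using M by (auto simp: vietoris_basic_def set_Us)
      then show False using S by blast
    qed
    then show "M \<in> V n K" using M MU by (auto simp: V_def vietoris_basic_def)
  qed
  ultimately show ?thesis by blast
qed

lemma V_open:
  assumes "K \<noteq> {}" "compactin X K"
  shows "openin (vietoris X) (V n K)"
proof (subst openin_subopen, intro ballI)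
  fix M assume M: "M \<in> V n K"
  then have "M \<noteq> {}" "compactin X M" by (simp_all add: V_def)
  then obtain W where "openin (vietoris X) W" "M \<in> W" "W \<subseteq> V n M"
    using V_nhd by meson
  then show "\<exists>W. openin (vietoris X) W \<and> M \<in> W \<and> W \<subseteq> V n K"
    using V_trans[OF compactin_subset_topspace[OF assms(2)] M] by blast
qed

text \<open>\<open>U_escape\<close> gives \<open>L \<subseteq> K\<close>. A point \<open>q\<close>
  of \<open>K\<close> outside \<open>L\<close> is missed by finitely many cells covering
  \<open>L\<close>, which are admissible for large \<open>n\<close>, a contradiction.\<close>

lemma V_sep:
  assumes K: "compactin X K" and L: "\<And>n. L \<in> V n K"
  shows "L = K"
proof (rule ccontr)
  assume "L \<noteq> K"
  have KX: "K \<subseteq> topspace X" using K by (rule compactin_subset_topspace)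
  have cL: "compactin X L" using L[of 0] by (auto simp: V_def)
  have LX: "L \<subseteq> topspace X" using cL by (rule compactin_subset_topspace)
  have "L \<subseteq> K"
  proof
    fix y assume "y \<in> L"
    then have "y \<in> U n K" for n using L[of n] by (auto simp: V_def)
    then show "y \<in> K" using U_escape[OF K] \<open>y \<in> L\<close> LX by blast
  qed
  then obtain q where q: "q \<in> K" "q \<notin> L" using \<open>L \<noteq> K\<close> by blast
  have "\<forall>y\<in>L. \<exists>i. q \<notin> D i y" using D_sep q KX LX by blast
  then obtain i where i: "\<And>y. y \<in> L \<Longrightarrow> q \<notin> D (i y) y" by metis
  have "\<forall>y\<in>L. \<exists>m. \<forall>n\<ge>m. maximal_for n (i y) K y"
    using maximal_for_eventually[OF K] LX by blast
  then obtain m where m: "\<And>y n. y \<in> L \<Longrightarrow> n \<ge> m y \<Longrightarrow> maximal_for n (i y) K y" by metis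
  have "\<forall>y\<in>L. \<exists>O'. openin X O' \<and> y \<in> O' \<and> O' \<subseteq> D (i y) y" using D_nhd LX by blast
  then obtain O' where O': "\<And>y. y \<in> L \<Longrightarrow> openin X (O' y) \<and> y \<in> O' y \<and> O' y \<subseteq> D (i y) y" by metis
  obtain F where F: "finite F" "F \<subseteq> L" "L \<subseteq> (\<Union>y\<in>F. O' y)"
    by (rule compactin_neighbourhood_cover[OF cL, of O']) (use O' in auto)
  \<comment> \<open>Large enough for both maximality (\<open>m y\<close>) and the index bound in
    \<open>cells\<close> (\<open>i y\<close>); the \<open>0\<close> keeps the set under
    \<open>Max\<close> nonempty.\<close>
  define n where "n = Max (insert 0 ((\<lambda>y. max (m y) (i y)) ` F))"
  have n: "m y \<le> n \<and> i y \<le> n" if "y \<in> F" for y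
  proof -
    have "max (m y) (i y) \<le> n" unfolding n_def using F(1) that by (intro Max_ge) auto
    then show ?thesis by simp
  qed
  define S where "S = (\<lambda>y. D (i y) y) ` F"
  have "S \<subseteq> cells n K L" using F m n unfolding S_def cells_def by blast
  moreover have "L \<subseteq> \<Union>S" using F O' unfolding S_def by blast
  ultimately have "K \<subseteq> \<Union>S" using L[of n] by (simp add: V_def)
  then show False using q i F unfolding S_def by blast
qed

lemma alpha_space_vietoris: "alpha_space (vietoris X)"
  unfolding alpha_space_def topspace_vietoris
proof (intro exI[of _ V] conjI allI ballI impI)
  fix n K assume "K \<in> {K. K \<noteq> {} \<and> compactin X K}"
  then show "openin (vietoris X) (V n K)" by (simp add: V_open)
next
  fix K assume "K \<in> {K. K \<noteq> {} \<and> compactin X K}"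
  then have "K \<noteq> {}" "compactin X K" by auto
  then show "(\<Inter>n. V n K) = {K}" using V_sep[of K] V_refl[of K] by auto
next
  fix n K L assume "K \<in> {K. K \<noteq> {} \<and> compactin X K}" "L \<in> V n K"
  then show "V n L \<subseteq> V n K" by (simp add: V_trans compactin_subset_topspace)
qed

end

section \<open>Closed cells from regularity and a well-order\<close>

lemma alpha_space_imp_closed_cells:
  assumes reg: "regular_space X" and "alpha_space X"
  shows "\<exists>T D. closed_cells X T D"
proof -
  obtain g :: "nat \<Rightarrow> 'a \<Rightarrow> 'a set"
    where op: "\<And>i x. x \<in> topspace X \<Longrightarrow> openin X (g i x)"
      and sep: "\<And>x. x \<in> topspace X \<Longrightarrow> (\<Inter>i. g i x) = {x}"
      and tr0: "\<And>i x y. x \<in> topspace X \<Longrightarrow> y \<in> topspace X \<Longrightarrow> y \<in> g i x \<Longrightarrow> g i y \<subseteq> g i x"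
    using assms(2) unfolding alpha_space_def by metis
  have sub: "g i x \<subseteq> topspace X" if "x \<in> topspace X" for i x
    using op[OF that] by (rule openin_subset)
  have tr: "g i y \<subseteq> g i x" if "x \<in> topspace X" "y \<in> g i x" for i x y
    using tr0 that sub by blast
  have refl: "x \<in> g i x" if "x \<in> topspace X" for i x
    using sep[OF that] by blast
  have "\<forall>i. \<forall>x\<in>topspace X. \<exists>H C. openin X H \<and> closedin X C \<and> x \<in> H \<and> H \<subseteq> C \<and> C \<subseteq> g i x"
    using reg op refl unfolding neighbourhood_base_of_closedin[symmetric] neighbourhood_base_of by meson
  then obtain H C where HC: "\<And>i x. x \<in> topspace X \<Longrightarrow>
      openin X (H i x) \<and> closedin X (C i x) \<and> x \<in> H i x \<and> H i x \<subseteq> C i x \<and> C i x \<subseteq> g i x"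
    by metis
  obtain r :: "'a rel" where "well_order_on UNIV r" using well_order_on by blast
  then have wf: "wf (r - Id)" and lin: "\<And>x y. (x, y) \<in> r \<or> (y, x) \<in> r"
    and r_trans: "trans r" and r_antisym: "antisym r"
    unfolding well_order_on_def linear_order_on_def partial_order_on_def preorder_on_def
      total_on_def refl_on_def by (auto, metis)
  \<comment> \<open>Candidate centres for \<open>a\<close>: points of its \<open>g i\<close>-class
    whose chosen neighbourhood contains \<open>a\<close>. As \<open>a\<close> itself qualifies, a
    least one \<open>\<rho> i a\<close> exists.\<close>
  define Q where "Q i a = {x \<in> topspace X. g i x = g i a \<and> a \<in> H i x}" for i a
  have "\<exists>z\<in>Q i a. \<forall>w\<in>Q i a. (z, w) \<in> r" if "a \<in> topspace X" for i a
  proof -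
    have "a \<in> Q i a" using HC that by (auto simp: Q_def)
    then obtain z where "z \<in> Q i a" "\<And>w. (w, z) \<in> r - Id \<Longrightarrow> w \<notin> Q i a"
      using wf by (metis wfE_min)
    then show ?thesis using lin by blast
  qed
  then have "\<forall>i. \<forall>a\<in>topspace X. \<exists>z. z \<in> Q i a \<and> (\<forall>w\<in>Q i a. (z, w) \<in> r)"
    by blast
  then obtain \<rho> where \<rho>: "\<And>i a. a \<in> topspace X \<Longrightarrow> \<rho> i a \<in> Q i a"
    and \<rho>_min: "\<And>i a w. a \<in> topspace X \<Longrightarrow> w \<in> Q i a \<Longrightarrow> (\<rho> i a, w) \<in> r"
    unfolding bchoice_iff choice_iff by auto
  \<comment> \<open>Lexicographic order: first by \<open>g i\<close>, then by the centre within a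
    \<open>g i\<close>-class.\<close>
  define T where "T i a = {b \<in> g i a. g i b = g i a \<longrightarrow> (\<rho> i b, \<rho> i a) \<in> r}" for i a
  define D where "D i a = C i (\<rho> i a)" for i a
  have D_sub: "D i a \<subseteq> g i a" if "a \<in> topspace X" for i a
    using HC[of "\<rho> i a" i] \<rho>[OF that, of i] by (auto simp: D_def Q_def)
  have T_trans: "T i b \<subseteq> T i a" if a: "a \<in> topspace X" and b: "b \<in> T i a" for i a b
  proof
    fix c assume c: "c \<in> T i b"
    have bg: "b \<in> g i a" using b by (simp add: T_def)
    have bX: "b \<in> topspace X" using bg sub a by blast
    have cg: "c \<in> g i b" using c by (simp add: T_def)
    have "g i c \<subseteq> g i b" "g i b \<subseteq> g i a" by (rule tr[OF bX cg], rule tr[OF a bg])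
    have "(\<rho> i c, \<rho> i a) \<in> r" if "g i c = g i a"
    proof -
      have "g i c = g i b" "g i b = g i a"
        using that \<open>g i c \<subseteq> g i b\<close> \<open>g i b \<subseteq> g i a\<close> by auto
      then have "(\<rho> i c, \<rho> i b) \<in> r" "(\<rho> i b, \<rho> i a) \<in> r"
        using b c by (simp_all add: T_def)
      then show ?thesis by (rule transD[OF r_trans])
    qed
    then show "c \<in> T i a" using cg \<open>g i b \<subseteq> g i a\<close> by (auto simp: T_def)
  qed
  have H_sub: "H i (\<rho> i a) \<subseteq> T i a" if a: "a \<in> topspace X" for i a
  proof
    fix b assume b: "b \<in> H i (\<rho> i a)"
    have q: "\<rho> i a \<in> topspace X" "g i (\<rho> i a) = g i a" using \<rho>[OF a] by (auto simp: Q_def)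
    have bg: "b \<in> g i a" using b HC[OF q(1), of i] q by blast
    have bX: "b \<in> topspace X" using bg sub a by blast
    \<comment> \<open>The centre of \<open>a\<close> is also a candidate for \<open>b\<close>, so
      the least candidate for \<open>b\<close> cannot come later.\<close>
    have "(\<rho> i b, \<rho> i a) \<in> r" if "g i b = g i a"
      using bX b q that by (intro \<rho>_min) (auto simp: Q_def)
    then show "b \<in> T i a" using bg by (simp add: T_def)
  qed
  have H_nhd: "openin X (H i (\<rho> i a)) \<and> a \<in> H i (\<rho> i a) \<and> H i (\<rho> i a) \<subseteq> D i a"
    if a: "a \<in> topspace X" for i a
    using HC[of "\<rho> i a" i] \<rho>[OF a, of i] by (auto simp: D_def Q_def)
  have "closed_cells X T D"
  proof
    fix i a assume a: "a \<in> topspace X"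
    show "openin X (T i a)"
    proof (subst openin_subopen, intro ballI)
      fix b assume b: "b \<in> T i a"
      then have bX: "b \<in> topspace X" using sub[OF a] by (auto simp: T_def)
      show "\<exists>W. openin X W \<and> b \<in> W \<and> W \<subseteq> T i a"
        using H_nhd[OF bX] H_sub[OF bX] T_trans[OF a b] by blast
    qed
    show "a \<in> T i a" using H_nhd[OF a] H_sub[OF a] by blast
    show "closedin X (D i a)"
      using HC \<rho>[OF a, of i] by (simp add: D_def Q_def)
    show "\<exists>W. openin X W \<and> a \<in> W \<and> W \<subseteq> D i a" using H_nhd[OF a] by blast
  next
    fix i a b assume "a \<in> topspace X" "b \<in> T i a"
    then show "T i b \<subseteq> T i a" by (rule T_trans)
  next
    fix a b assume ab: "a \<in> topspace X" "b \<in> topspace X" "a \<noteq> b"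
    then have "b \<notin> (\<Inter>i. g i a)" using sep by simp
    then obtain i where i: "b \<notin> g i a" by blast
    show "\<exists>i. b \<notin> T i a" using i by (auto simp: T_def)
    show "\<exists>i. b \<notin> D i a" using i D_sub[OF ab(1)] by blast
  next
    fix i a b assume ab: "a \<in> topspace X" "b \<in> topspace X" "T i a = T i b"
    \<comment> \<open>Mutual membership forces equal \<open>g i\<close>-classes and then, by
      antisymmetry, equal centres, on which alone \<open>D\<close> depends.\<close>
    have "a \<in> T i b" "b \<in> T i a"
      using H_nhd[OF ab(1)] H_sub[OF ab(1)] H_nhd[OF ab(2)] H_sub[OF ab(2)] ab(3) by blast+
    moreover from this have "g i a = g i b"
      using tr[of a b i] tr[of b a i] ab unfolding T_def by blast
    ultimately have "(\<rho> i a, \<rho> i b) \<in> r" "(\<rho> i b, \<rho> i a) \<in> r"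
      by (auto simp: T_def)
    then have "\<rho> i a = \<rho> i b" by (rule antisymD[OF r_antisym])
    then show "D i a = D i b" by (simp add: D_def)
  qed
  then show ?thesis by blast
qed

theorem theorem3p14:
  fixes X :: "'a topology"
  assumes "regular_space X" and "Hausdorff_space X"
  shows "alpha_space X \<longleftrightarrow> alpha_space (vietoris X)"
  using alpha_space_imp_closed_cells[OF assms(1)] closed_cells.alpha_space_vietoris
    alpha_space_if_vietoris by blast

end
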